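(* Let $(S_n)_{n\ge0}$ be the binomial sequence attached to a delta operator $\mathfrak{d}=\varphi(\partial/\partial t)$ on $\mathbb{C}[t]$, where $\varphi\in\mathbb{C}[[z]]$, $\varphi(0)=0$, $\varphi'(0)\neq0$. Let $(A_n)_{n\ge0}$ be the Appell sequence whose generating series is $$\sum_{n=0}^{+\infty}\frac{A_n(t)}{n!}z^n=\frac{\exp(tz)}{z\,\mathrm{D}_{\log}(\varphi(z))},\qquad \mathrm{D}_{\log}(\varphi(z))=\frac{\varphi'(z)}{\varphi(z)}.$$ Then for every $n$ the deviation polynomial $R_n$ is given by $$R_n(t)=\left(\mathfrak{d}\,(\partial/\partial t)^{-1}\right)^nA_n(t)=\underbrace{\frac{\mathfrak{d}t^{n+1}}{n+1}\boxplus_n\cdots\boxplus_n\frac{\mathfrak{d}t^{n+1}}{n+1}}_{n\ \text{times}}\boxplus_n A_n(t).$$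
   Context: The binomial sequence attached to $\mathfrak{d}$ is the unique sequence $(S_n)_{n\ge0}$ of polynomials with $\deg S_n=n$, $S_0=1$, and $\mathfrak{d}S_n=nS_{n-1}$, $S_n(0)=0$ for $n\ge1$. An Appell sequence is a sequence of polynomials $(A_n)_{n\ge0}$ with $\deg A_n=n$ and $A_n'=nA_{n-1}$. Classical additive convolution on the space $\mathbb{C}_n[t]$ of polynomials of degree at most $n$ is $(A\boxplus_nB)(z)=\frac1{n!}\sum_{k=0}^nA^{(k)}(0)\,B^{(n-k)}(z)$; it is commutative and associative with unit $t^n$. The deviation polynomial $R_n\in\mathbb{C}_n[t]$ is the inverse of $S_n$ for $\boxplus_n$, i.e. $R_n\boxplus_nS_n=t^n$. The operator $\mathfrak{d}(\partial/\partial t)^{-1}$ sends a polynomial $P$ to $\mathfrak{d}\widehat P$, where $\widehat P$ is any primitive of $P$ (well defined since $\mathfrak{d}(1)=0$); equivalently it is the operator $\psi(\partial/\partial t)$ with $\psi(z)=\varphi(z)/z$. *)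

theory Defs
  imports "HOL-Computational_Algebra.Computational_Algebra"
begin

text \<open>The operator \<open>\<phi>(\<partial>/\<partial>t)\<close> on \<open>\<complex>[t]\<close>. The sum stops at \<open>degree P\<close> because all higher
  derivatives of \<open>P\<close> vanish.\<close>

definition diff_op :: "complex fps \<Rightarrow> complex poly \<Rightarrow> complex poly" where
  "diff_op \<phi> P = (\<Sum>k\<le>degree P. smult (fps_nth \<phi> k) ((pderiv ^^ k) P))"

definition binomial_sequence ::
    "(complex poly \<Rightarrow> complex poly) \<Rightarrow> (nat \<Rightarrow> complex poly) \<Rightarrow> bool" where
  "binomial_sequence \<dd> S \<longleftrightarrow>
     (\<forall>n. degree (S n) = n) \<and> S 0 = 1 \<and>
     (\<forall>n\<ge>1. \<dd> (S n) = smult (of_nat n) (S (n - 1)) \<and> poly (S n) 0 = 0)"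

text \<open>\<open>A 0 \<noteq> 0\<close> follows from \<open>degree (A 1) = 1\<close> and \<open>pderiv (A 1) = A 0\<close>.\<close>

definition appell_sequence :: "(nat \<Rightarrow> complex poly) \<Rightarrow> bool" where
  "appell_sequence A \<longleftrightarrow>
     (\<forall>n. degree (A n) = n) \<and> (\<forall>n\<ge>1. pderiv (A n) = smult (of_nat n) (A (n - 1)))"

text \<open>\<open>\<phi>'/\<phi>\<close> has a simple pole at \<open>0\<close> when \<open>\<phi>(0) = 0\<close> and \<open>\<phi>'(0) \<noteq> 0\<close>, so it is formed in the
  field of formal Laurent series (division of formal power series would drop the pole).\<close>

definition Dlog :: "complex fps \<Rightarrow> complex fls" where
  "Dlog \<phi> = fls_deriv (fps_to_fls \<phi>) / fps_to_fls \<phi>"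

definition boxplus :: "nat \<Rightarrow> complex poly \<Rightarrow> complex poly \<Rightarrow> complex poly" where
  "boxplus n A B =
     smult (1 / fact n) (\<Sum>k\<le>n. smult (poly ((pderiv ^^ k) A) 0) ((pderiv ^^ (n - k)) B))"

text \<open>The inverse of \<open>P\<close> for \<open>boxplus n\<close>. It exists and is unique when \<open>degree P = n\<close>, see
  \<open>deviation_poly_unique\<close> below.\<close>

definition deviation_poly :: "nat \<Rightarrow> complex poly \<Rightarrow> complex poly" where
  "deviation_poly n P = (THE R. degree R \<le> n \<and> boxplus n R P = monom 1 n)"

text \<open>The primitive of \<open>P\<close> with constant term \<open>0\<close>. The choice does not matter for
  \<open>delta_primitive\<close>, see \<open>delta_primitive_any\<close> below.\<close>

definition poly_primitive :: "complex poly \<Rightarrow> complex poly" where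
  "poly_primitive P = (\<Sum>i\<le>degree P. monom (coeff P i / of_nat (Suc i)) (Suc i))"

definition delta_primitive :: "(complex poly \<Rightarrow> complex poly) \<Rightarrow> complex poly \<Rightarrow> complex poly" where
  "delta_primitive \<dd> P = \<dd> (poly_primitive P)"

lemma pderiv_poly_primitive: "pderiv (poly_primitive P) = P"
proof -
  have "pderiv (poly_primitive P) = (\<Sum>i\<le>degree P. monom (coeff P i) i)"
    unfolding poly_primitive_def higher_pderiv_sum[of 1, simplified]
    by (intro sum.cong refl) (simp add: pderiv_monom del: of_nat_Suc)
  then show ?thesis by (simp add: poly_as_sum_of_monoms)
qed

lemma diff_op_conv_sum:
  assumes "degree P \<le> N"
  shows "diff_op \<phi> P = (\<Sum>k\<le>N. smult (fps_nth \<phi> k) ((pderiv ^^ k) P))"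
  unfolding diff_op_def
proof (rule sum.mono_neutral_left)
  show "\<forall>k\<in>{..N} - {..degree P}. smult (fps_nth \<phi> k) ((pderiv ^^ k) P) = 0"
  proof
    fix k assume "k \<in> {..N} - {..degree P}"
    then have "(pderiv ^^ k) P = 0"
      by (intro poly_eqI) (simp add: coeff_higher_pderiv coeff_eq_0)
    then show "smult (fps_nth \<phi> k) ((pderiv ^^ k) P) = 0" by simp
  qed
qed (use assms in auto)

lemma delta_primitive_any:
  assumes "fps_nth \<phi> 0 = 0" and "pderiv Q = P"
  shows "delta_primitive (diff_op \<phi>) P = diff_op \<phi> Q"
proof -
  define Q' where "Q' = poly_primitive P"
  define N where "N = max (degree Q) (degree Q')"
  have "(pderiv ^^ k) Q' = (pderiv ^^ k) Q" if "k \<noteq> 0" for k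
    using that assms(2) pderiv_poly_primitive[of P]
    by (cases k) (simp_all add: Q'_def funpow_Suc_right del: funpow.simps)
  then have "(\<Sum>k\<le>N. smult (fps_nth \<phi> k) ((pderiv ^^ k) Q')) =
      (\<Sum>k\<le>N. smult (fps_nth \<phi> k) ((pderiv ^^ k) Q))"
    using assms(1) by (intro sum.cong refl) (metis smult_0_left)
  then show ?thesis
    by (simp add: delta_primitive_def Q'_def[symmetric] N_def
        diff_op_conv_sum[of Q "max (degree Q) (degree Q')"]
        diff_op_conv_sum[of Q' "max (degree Q) (degree Q')"])
qed

text \<open>Under this map \<open>boxplus n\<close> becomes multiplication of power series modulo \<open>z\<^sup>n\<^sup>+\<^sup>1\<close>, up to the
  factor \<open>n!\<close>.\<close>

definition reversed_series :: "nat \<Rightarrow> complex poly \<Rightarrow> complex fps" where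
  "reversed_series n A = Abs_fps (\<lambda>p. if p \<le> n then fact (n - p) * coeff A (n - p) else 0)"

lemma coeff_boxplus:
  assumes "degree B \<le> n"
  shows "coeff (boxplus n A B) m =
    (if m \<le> n then fps_nth (reversed_series n A * reversed_series n B) (n - m) / (fact n * fact m)
     else 0)"
proof -
  have c0: "poly ((pderiv ^^ k) A) 0 = fact k * coeff A k" for k
    by (simp add: poly_0_coeff_0 coeff_higher_pderiv pochhammer_fact)
  have cB: "coeff ((pderiv ^^ (n - k)) B) m = fact (m + n - k) * coeff B (m + n - k) / fact m"
    if "k \<le> n" for k
  proof -
    have "fact m * pochhammer (of_nat (Suc m)) (n - k) = (fact (m + (n - k)) :: complex)"
      by (simp add: pochhammer_fact pochhammer_product'[of 1 m] add.commute)
    then have "pochhammer (of_nat (Suc m)) (n - k) = (fact (m + n - k) :: complex) / fact m"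
      using that by (simp add: field_simps)
    then show ?thesis
      using that by (simp add: coeff_higher_pderiv del: of_nat_Suc)
  qed
  have *: "coeff (boxplus n A B) m =
     (\<Sum>k\<le>n. fact k * coeff A k * (fact (m + n - k) * coeff B (m + n - k))) / (fact n * fact m)"
    by (simp add: boxplus_def coeff_sum c0 cB sum_divide_distrib mult.commute[of "fact n"])
  show ?thesis
  proof (cases "m \<le> n")
    case False
    then have "coeff B (m + n - k) = 0" if "k \<le> n" for k
      using assms that by (intro coeff_eq_0) auto
    with False show ?thesis unfolding * by (simp)
  next
    case True
    have "(\<Sum>k\<le>n. fact k * coeff A k * (fact (m + n - k) * coeff B (m + n - k))) =
       (\<Sum>k\<in>{m..n}. fact k * coeff A k * (fact (m + n - k) * coeff B (m + n - k)))"
      using assms by (intro sum.mono_neutral_right) (auto intro!: coeff_eq_0)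
    also have "\<dots> = (\<Sum>p=0..n - m. fps_nth (reversed_series n A) p *
        fps_nth (reversed_series n B) (n - m - p))"
      using True
      by (intro sum.reindex_bij_witness[of _ "\<lambda>p. n - p" "\<lambda>k. n - k"])
        (auto simp: reversed_series_def Suc_diff_le algebra_simps)
    finally show ?thesis using True unfolding * by (simp add: fps_mult_nth)
  qed
qed

lemma deviation_poly_unique:
  assumes "degree P = n" and "P \<noteq> 0"
  shows "\<exists>!R. degree R \<le> n \<and> boxplus n R P = monom 1 n"
proof (rule ex_ex1I)
  define G where "G = fps_const ((fact n)\<^sup>2) * inverse (reversed_series n P)"
  define R where "R = (\<Sum>m\<le>n. monom (fps_nth G (n - m) / fact m) m)"
  have unit: "fps_nth (reversed_series n P) 0 \<noteq> 0"
    using assms leading_coeff_neq_0[of P] by (simp add: reversed_series_def)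
  have cR: "coeff R m = (if m \<le> n then fps_nth G (n - m) / fact m else 0)" for m
    by (auto simp: R_def coeff_sum)
  have deg: "degree R \<le> n"
    by (rule degree_le) (simp add: cR)
  have R_G: "fps_nth (reversed_series n R) p = fps_nth G p" if "p \<le> n" for p
    using that by (simp add: reversed_series_def cR)
  have GP: "G * reversed_series n P = fps_const ((fact n)\<^sup>2)"
    using unit by (simp add: G_def mult.assoc inverse_mult_eq_1)
  have "boxplus n R P = monom 1 n"
  proof (rule poly_eqI)
    fix m
    have "fps_nth (reversed_series n R * reversed_series n P) (n - m) =
        fps_nth (G * reversed_series n P) (n - m)"
      unfolding fps_mult_nth by (intro sum.cong refl) (simp add: R_G)
    then show "coeff (boxplus n R P) m = coeff (monom 1 n) m"
      using assms(1) by (auto simp: coeff_boxplus GP power2_eq_square)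
  qed
  with deg show "\<exists>R. degree R \<le> n \<and> boxplus n R P = monom 1 n" by blast
next
  fix R R' :: "complex poly"
  assume R: "degree R \<le> n \<and> boxplus n R P = monom 1 n"
    and R': "degree R' \<le> n \<and> boxplus n R' P = monom 1 n"
  let ?D = "reversed_series n R - reversed_series n R'"
  have unit: "fps_nth (reversed_series n P) 0 \<noteq> 0"
    using assms leading_coeff_neq_0[of P] by (simp add: reversed_series_def)
  have zero: "fps_nth (?D * reversed_series n P) i = 0" if "i \<le> n" for i
  proof -
    have "coeff (boxplus n R P) (n - i) = coeff (boxplus n R' P) (n - i)"
      using R R' by simp
    then show ?thesis
      using that assms(1) by (simp add: coeff_boxplus left_diff_distrib)
  qed
  have "?D = 0"
  proof (rule ccontr)
    assume nz: "?D \<noteq> 0"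
    have "fps_nth ?D (subdegree ?D) \<noteq> 0"
      using nz by (rule nth_subdegree_nonzero)
    then have "subdegree ?D \<le> n"
      by (auto simp: reversed_series_def split: if_splits)
    moreover have "fps_nth (?D * reversed_series n P) (subdegree ?D) =
        fps_nth ?D (subdegree ?D) * fps_nth (reversed_series n P) 0"
      using unit nth_subdegree_mult[of ?D "reversed_series n P"]
      by (simp add: subdegree_eq_0)
    ultimately show False
      using zero \<open>fps_nth ?D (subdegree ?D) \<noteq> 0\<close> unit by simp
  qed
  then have eq: "fps_nth (reversed_series n R) p = fps_nth (reversed_series n R') p" for p
    by simp
  show "R = R'"
  proof (rule poly_eqI)
    fix m
    show "coeff R m = coeff R' m"
    proof (cases "m \<le> n")
      case True
      then show ?thesis using eq[of "n - m"] by (simp add: reversed_series_def)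
    next
      case False
      then show ?thesis using R R' by (simp add: coeff_eq_0)
    qed
  qed
qed

end

theory Submission
  imports Defs
begin

text \<open>Write \<open>\<phi> = z \<psi>\<close>. Every polynomial of degree at most \<open>n\<close> is \<open>f(\<partial>/\<partial>t) t\<^sup>n\<close> for some power series
  \<open>f\<close>, and \<open>\<boxplus>\<^sub>n\<close> multiplies these series. The hypothesis on \<open>A\<close> says that \<open>A\<^sub>n\<close> has series \<open>\<psi> / \<phi>'\<close>,
  and both \<open>\<dd> (\<partial>/\<partial>t)\<^sup>-\<^sup>1\<close> and convolution with \<open>\<dd> t\<^sup>n\<^sup>+\<^sup>1 / (n + 1)\<close> multiply the series by \<open>\<psi>\<close>. So the
  claim is the transfer formula: \<open>S\<^sub>n\<close> has series \<open>\<phi>' / \<psi>\<^sup>n\<^sup>+\<^sup>1\<close>. The polynomials with these series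
  satisfy the recursion of \<open>S\<close>, and they vanish at \<open>0\<close> for \<open>n > 0\<close> because \<open>\<phi>' / \<phi>\<^sup>n\<^sup>+\<^sup>1\<close> is a derivative
  and hence has no residue.\<close>

lemma degree_higher_pderiv: "degree ((pderiv ^^ k) P) = degree P - k" for P :: "complex poly"
  by (induction k) (simp_all add: degree_pderiv)

lemma smult_sum_right: "smult c (\<Sum>i\<in>I. f i) = (\<Sum>i\<in>I. smult c (f i))"
  by (induction I rule: infinite_finite_induct) (simp_all add: smult_add_right)

lemma higher_pderiv_diff_op: "(pderiv ^^ i) (diff_op f P) = diff_op f ((pderiv ^^ i) P)"
proof -
  have "(pderiv ^^ i) (diff_op f P) =
      (\<Sum>k\<le>degree P. smult (fps_nth f k) ((pderiv ^^ i) ((pderiv ^^ k) P)))"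
    by (simp add: diff_op_def higher_pderiv_sum higher_pderiv_smult)
  also have "\<dots> = diff_op f ((pderiv ^^ i) P)"
    by (subst diff_op_conv_sum[of _ "degree P"])
      (simp_all add: degree_higher_pderiv add.commute flip: funpow_add comp_apply[of "pderiv ^^ _"])
  finally show ?thesis .
qed

lemma degree_diff_op_le: "degree (diff_op f P) \<le> degree P"
  unfolding diff_op_def
  by (intro degree_sum_le) (auto simp: degree_higher_pderiv intro: order.trans[OF degree_smult_le])

lemma diff_op_smult: "diff_op f (smult c P) = smult c (diff_op f P)"
  by (subst diff_op_conv_sum[of _ "degree P"])
    (simp_all add: diff_op_def higher_pderiv_smult smult_sum_right mult.commute degree_smult_le)

lemma diff_op_diff: "diff_op f (P - Q) = diff_op f P - diff_op f Q"
proof -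
  define N where "N = max (degree P) (degree Q)"
  have "(pderiv ^^ k) (P - Q) = (pderiv ^^ k) P - (pderiv ^^ k) Q" for k
    by (induction k) (simp_all add: pderiv_diff)
  moreover have "degree P \<le> N" "degree Q \<le> N" "degree (P - Q) \<le> N"
    by (simp_all add: N_def degree_diff_le_max)
  ultimately show ?thesis
    by (simp add: diff_op_conv_sum[of _ N] smult_diff_right sum_subtractf)
qed

lemma diff_op_mult: "diff_op (f * g) P = diff_op f (diff_op g P)"
proof -
  define N where "N = degree P"
  have "diff_op f (diff_op g P) =
      (\<Sum>i\<le>N. smult (fps_nth f i) (diff_op g ((pderiv ^^ i) P)))"
    by (simp add: diff_op_conv_sum[of _ N f] N_def degree_diff_op_le higher_pderiv_diff_op)
  \<comment> \<open>The derivative \<open>(pderiv ^^ i) P\<close> has degree \<open>N - i\<close>,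
    so the inner sum stops there. The indices fill a triangle, and grouping them by
    \<open>i + j\<close> yields the coefficients of the Cauchy product.\<close>
  also have "\<dots> = (\<Sum>i\<le>N. \<Sum>j\<le>N - i. smult (fps_nth f i * fps_nth g j) ((pderiv ^^ (i + j)) P))"
    by (simp add: diff_op_def degree_higher_pderiv N_def smult_sum_right add.commute
        flip: funpow_add comp_apply[of "pderiv ^^ _"])
  also have "\<dots> = (\<Sum>(i, j)\<in>{(i, j). i + j \<le> N}.
      smult (fps_nth f i * fps_nth g j) ((pderiv ^^ (i + j)) P))"
    by (subst sum.Sigma) (auto intro!: sum.cong)
  also have "\<dots> = diff_op (f * g) P"
    by (simp add: sum.triangle_reindex_eq diff_op_def N_def fps_mult_nth smult_sum
        atLeast0AtMost)
  finally show ?thesis by simp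
qed

lemma diff_op_1: "diff_op 1 P = P"
proof -
  have "diff_op 1 P = (\<Sum>k\<in>{0}. smult (fps_nth 1 k) ((pderiv ^^ k) P))"
    unfolding diff_op_def by (intro sum.mono_neutral_right) auto
  then show ?thesis by simp
qed

lemma diff_op_X: "diff_op fps_X P = pderiv P"
proof -
  \<comment> \<open>The bound is raised by one so that the index 1 occurs even when \<open>P\<close>
    is constant.\<close>
  have "diff_op fps_X P = (\<Sum>k\<le>Suc (degree P). smult (fps_nth fps_X k) ((pderiv ^^ k) P))"
    by (rule diff_op_conv_sum) simp
  also have "\<dots> = (\<Sum>k\<in>{1}. smult (fps_nth fps_X k) ((pderiv ^^ k) P))"
    by (intro sum.mono_neutral_right) auto
  finally show ?thesis by simp
qed

lemma diff_op_power: "(diff_op f ^^ k) P = diff_op (f ^ k) P"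
  by (induction k) (simp_all add: diff_op_1 diff_op_mult)

lemma coeff_diff_op_monom:
  "coeff (diff_op f (monom 1 n)) m =
    (if m \<le> n then fact n / fact m * fps_nth f (n - m) else 0)"
proof (cases "m \<le> n")
  case True
  have "fact m * pochhammer (of_nat (Suc m)) (n - m) = (fact n :: complex)"
    using True pochhammer_product'[of "1 :: complex" m "n - m"]
    by (simp add: pochhammer_fact add.commute)
  then have poch: "pochhammer (of_nat (Suc m)) (n - m) = (fact n :: complex) / fact m"
    by (simp add: field_simps)
  have "coeff (diff_op f (monom 1 n)) m =
      (\<Sum>k\<le>n. fps_nth f k * coeff ((pderiv ^^ k) (monom 1 n)) m)"
    by (simp add: diff_op_def degree_monom_eq coeff_sum)
  also have "\<dots> = (\<Sum>k\<in>{n - m}. fps_nth f k * coeff ((pderiv ^^ k) (monom 1 n)) m)"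
    by (intro sum.mono_neutral_right) (auto simp: coeff_higher_pderiv)
  also have "\<dots> = fact n / fact m * fps_nth f (n - m)"
    using True by (simp add: coeff_higher_pderiv poch del: of_nat_Suc)
  finally show ?thesis using True by simp
next
  case False
  then show ?thesis
    using degree_diff_op_le[of f "monom 1 n"] by (simp add: degree_monom_eq coeff_eq_0)
qed

text \<open>The derivatives at 0 of \<open>diff_op f (monom 1 n)\<close> are, up to n!, the
  coefficients of \<open>f\<close> in reverse order. The convolution sum is therefore the sum for
  \<open>diff_op f B\<close> read backwards, and the degree bound ensures that it misses no
  term.\<close>

lemma boxplus_diff_op_monom:
  assumes "degree B \<le> n"
  shows "boxplus n (diff_op f (monom 1 n)) B = diff_op f B"
proof -
  have "poly ((pderiv ^^ k) (diff_op f (monom 1 n))) 0 = fact n * fps_nth f (n - k)" if "k \<le> n" for k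
    using that by (simp add: poly_0_coeff_0 coeff_higher_pderiv coeff_diff_op_monom
        flip: pochhammer_fact)
  then have "boxplus n (diff_op f (monom 1 n)) B =
      (\<Sum>k\<le>n. smult (fps_nth f (n - k)) ((pderiv ^^ (n - k)) B))"
    by (simp add: boxplus_def smult_sum_right)
  also have "\<dots> = diff_op f B"
    unfolding diff_op_conv_sum[OF assms]
    by (intro sum.reindex_bij_witness[of _ "\<lambda>k. n - k" "\<lambda>k. n - k"]) auto
  finally show ?thesis .
qed

text \<open>Convolution with a polynomial of series \<open>r\<close> acts as
  \<open>diff_op r\<close>, so the inverse series provides an inverse for \<open>boxplus n\<close>,
  and that inverse is unique.\<close>

lemma deviation_poly_diff_op_monom:
  assumes "degree P = n" "P \<noteq> 0" "P = diff_op s (monom 1 n)" "r * s = 1"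
  shows "deviation_poly n P = diff_op r (monom 1 n)"
  unfolding deviation_poly_def
proof (rule the1_equality[OF deviation_poly_unique], fact, fact, intro conjI)
  show "degree (diff_op r (monom 1 n)) \<le> n"
    using degree_diff_op_le[of r "monom 1 n"] by (simp add: degree_monom_eq)
  show "boxplus n (diff_op r (monom 1 n)) P = monom 1 n"
    using assms by (simp add: boxplus_diff_op_monom diff_op_1 flip: diff_op_mult)
qed

lemma delta_primitive_diff_op: "delta_primitive (diff_op (fps_X * \<psi>)) = diff_op \<psi>"
proof
  fix P
  have "delta_primitive (diff_op (fps_X * \<psi>)) P = diff_op (\<psi> * fps_X) (poly_primitive P)"
    by (simp add: delta_primitive_def mult.commute)
  then show "delta_primitive (diff_op (fps_X * \<psi>)) P = diff_op \<psi> P"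
    by (simp add: diff_op_mult diff_op_X pderiv_poly_primitive)
qed

text \<open>The factor \<open>fps_X\<close> differentiates the monomial. This serves both the
  recursion of the binomial sequence and the repeated convolution factor.\<close>

lemma diff_op_X_mult_monom_Suc:
  "diff_op (fps_X * \<psi>) (monom 1 (Suc n)) = smult (of_nat (Suc n)) (diff_op \<psi> (monom 1 n))"
proof -
  have "diff_op (fps_X * \<psi>) (monom 1 (Suc n)) = diff_op \<psi> (pderiv (monom 1 (Suc n)))"
    by (simp add: mult.commute[of fps_X] diff_op_mult diff_op_X)
  also have "pderiv (monom 1 (Suc n)) = smult (of_nat (Suc n)) (monom (1::complex) n)"
    by (simp add: pderiv_monom smult_monom)
  finally show ?thesis by (simp only: diff_op_smult)
qed

text \<open>The series \<psi> is invertible, so its operator can be undone and only the derivative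
  remains. Hence the recursion determines each polynomial up to a constant.\<close>

lemma diff_op_X_mult_eq_0_imp_const:
  assumes "diff_op (fps_X * \<psi>) P = 0" "fps_nth \<psi> 0 \<noteq> 0"
  shows "pderiv P = 0"
proof -
  have "pderiv P = diff_op (inverse \<psi>) (diff_op \<psi> (diff_op fps_X P))"
    using assms(2) by (simp add: diff_op_1 diff_op_X inverse_mult_eq_1 flip: diff_op_mult)
  also have "diff_op \<psi> (diff_op fps_X P) = 0"
    using assms(1) by (simp add: mult.commute flip: diff_op_mult)
  finally show ?thesis by (simp add: diff_op_def)
qed

text \<open>The coefficient is the residue of \<open>\<phi>' / \<phi>\<^sup>n\<^sup>+\<^sup>1\<close> for \<open>\<phi> = z / \<chi>\<close>.\<close>

lemma fps_nth_deriv_mult_power_eq_0: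
  fixes \<psi> \<chi> :: "complex fps"
  assumes "\<psi> * \<chi> = 1" "n > 0"
  shows "fps_nth (fps_deriv (fps_X * \<psi>) * \<chi> ^ Suc n) n = 0"
proof -
  obtain m where n: "n = Suc m" using assms(2) by (cases n) auto
  have "fps_deriv (\<psi> * \<chi>) = 0" by (simp add: assms(1))
  then have "fps_deriv \<psi> * \<chi> = - (\<psi> * fps_deriv \<chi>)"
    by (simp add: eq_neg_iff_add_eq_0 add.commute)
  have "fps_deriv (fps_X * \<psi>) * \<chi> ^ Suc n =
      (\<psi> * \<chi>) * \<chi> ^ n + fps_X * (fps_deriv \<psi> * \<chi>) * \<chi> ^ n"
    by (simp add: algebra_simps)
  also have "\<dots> = \<chi> ^ n - fps_X * (\<psi> * \<chi>) * (fps_deriv \<chi> * \<chi> ^ m)"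
    unfolding \<open>fps_deriv \<psi> * \<chi> = _\<close> using assms(1)
    by (simp add: n algebra_simps)
  finally have *: "fps_deriv (fps_X * \<psi>) * \<chi> ^ Suc n = \<chi> ^ n - fps_X * (fps_deriv \<chi> * \<chi> ^ m)"
    by (simp add: assms(1))
  \<comment> \<open>Both terms left in the coefficient at n agree: n times the second series,
    without its \<open>fps_X\<close>, is the derivative of \<open>\<chi> ^ n\<close>, whose
    coefficient at m is n times that of \<open>\<chi> ^ n\<close> at n.\<close>
  have "fps_deriv (\<chi> ^ n) = fps_const (of_nat n) * (fps_deriv \<chi> * \<chi> ^ m)"
    by (simp add: fps_deriv_power n mult.assoc del: power_Suc of_nat_Suc)
  then have "of_nat n * fps_nth (\<chi> ^ n) n = of_nat n * fps_nth (fps_deriv \<chi> * \<chi> ^ m) m"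
    by (metis fps_deriv_nth fps_mult_left_const_nth n Suc_eq_plus1)
  then show ?thesis
    using assms(2) unfolding * by (simp add: n del: of_nat_Suc power_Suc)
qed

lemma binomial_sequence_eq_diff_op_monom:
  assumes "binomial_sequence (diff_op (fps_X * \<psi>)) S" "\<psi> * \<chi> = 1"
  shows "S n = diff_op (fps_deriv (fps_X * \<psi>) * \<chi> ^ Suc n) (monom 1 n)"
proof (induction n)
  case 0
  \<comment> \<open>The derivative of \<open>fps_X * \<psi>\<close> has the constant coefficient of
    \<psi>, so the series for n = 0 starts with 1.\<close>
  have "fps_nth \<psi> 0 * fps_nth \<chi> 0 = 1"
    by (metis assms(2) fps_mult_nth_0 fps_one_nth)
  then have "coeff (diff_op (fps_deriv (fps_X * \<psi>) * \<chi> ^ Suc 0) (monom 1 0)) m = coeff 1 m" for m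
    by (simp add: coeff_diff_op_monom del: monom_eq_1)
  with assms(1) show ?case by (simp add: binomial_sequence_def poly_eqI)
next
  case (Suc n)
  define T where "T = diff_op (fps_deriv (fps_X * \<psi>) * \<chi> ^ Suc (Suc n)) (monom 1 (Suc n))"
  \<comment> \<open>The factor \<psi> cancels one \<chi>, and the remaining \<open>fps_X\<close>
    lowers the monomial from degree n + 1 to n, where the induction hypothesis applies.\<close>
  have "fps_X * \<psi> * (fps_deriv (fps_X * \<psi>) * \<chi> ^ Suc (Suc n)) =
      (\<psi> * \<chi>) * (fps_X * (fps_deriv (fps_X * \<psi>) * \<chi> ^ Suc n))"
    by (simp add: mult_ac)
  then have "diff_op (fps_X * \<psi>) T =
      diff_op (fps_X * (fps_deriv (fps_X * \<psi>) * \<chi> ^ Suc n)) (monom 1 (Suc n))"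
    unfolding T_def by (simp only: assms(2) mult_1 flip: diff_op_mult)
  also have "\<dots> = smult (of_nat (Suc n)) (S n)"
    by (simp only: diff_op_X_mult_monom_Suc Suc)
  also have "\<dots> = diff_op (fps_X * \<psi>) (S (Suc n))"
    using assms(1) by (simp add: binomial_sequence_def)
  finally have "diff_op (fps_X * \<psi>) (S (Suc n) - T) = 0"
    by (simp add: diff_op_diff)
  moreover have "fps_nth \<psi> 0 \<noteq> 0"
    by (metis assms(2) fps_mult_nth_0 fps_one_nth mult_zero_left zero_neq_one)
  ultimately have "pderiv (S (Suc n) - T) = 0"
    by (rule diff_op_X_mult_eq_0_imp_const)
  then obtain c where c: "S (Suc n) - T = [:c:]"
    by (metis pderiv_eq_0_iff degree_0_id)
  have "poly (S (Suc n)) 0 = 0"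
    using assms(1) by (simp add: binomial_sequence_def)
  \<comment> \<open>The constant term of \<open>T\<close> is (n + 1)! times the coefficient of its
    series at n + 1, which is the vanishing residue.\<close>
  moreover have "poly T 0 = 0"
    using fps_nth_deriv_mult_power_eq_0[OF assms(2), of "Suc n"]
    by (simp add: T_def poly_0_coeff_0 coeff_diff_op_monom del: power_Suc fps_deriv_mult)
  ultimately have "c = 0"
    using arg_cong[OF c, of "\<lambda>p. poly p 0"] by simp
  with c show ?case by (simp add: T_def)
qed

text \<open>The series exp(tz) generates the polynomials \<open>t^n / n!\<close>, and applying the
  operator of \<open>a\<close> in t multiplies it by a(z). The proof compares coefficients for each
  t.\<close>

lemma eq_diff_op_monom_if_exp_generating_series:
  assumes "\<And>t. Abs_fps (\<lambda>n. poly (A n) t / fact n) = fps_exp t * a"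
  shows "A n = diff_op a (monom 1 n)"
proof -
  have "poly (A n) t = poly (diff_op a (monom 1 n)) t" for t
  proof -
    have "poly (A n) t / fact n = (\<Sum>k\<le>n. t ^ k / fact k * fps_nth a (n - k))"
      using arg_cong[OF assms[of t], of "\<lambda>f. fps_nth f n"]
      by (simp add: fps_mult_nth atLeast0AtMost)
    then have "poly (A n) t = (\<Sum>k\<le>n. fact n / fact k * fps_nth a (n - k) * t ^ k)"
      by (simp add: field_simps sum_distrib_left)
    moreover have "degree (diff_op a (monom 1 n)) \<le> n"
      using degree_diff_op_le[of a "monom 1 n"] by (simp add: degree_monom_eq)
    ultimately show ?thesis
      by (subst poly_as_sum_of_monoms'[of "diff_op a (monom 1 n)" n, symmetric])
        (simp_all add: poly_sum poly_monom coeff_diff_op_monom)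
  qed
  then show ?thesis by (simp add: poly_eq_poly_eq_iff[symmetric] fun_eq_iff)
qed

text \<open>Multiplication by \<open>fls_X\<close> removes the pole caused by the factor
  \<open>fps_X\<close> in the denominator.\<close>

lemma X_mult_Dlog:
  assumes "\<psi> \<noteq> 0"
  shows "fls_X * Dlog (fps_X * \<psi>) = fps_to_fls (fps_deriv (fps_X * \<psi>)) / fps_to_fls \<psi>"
  using assms
  by (simp add: Dlog_def fls_times_fps_to_fls fls_deriv_fps_to_fls field_simps)

theorem theorem1p4:
  fixes \<phi> :: "complex fps" and S A :: "nat \<Rightarrow> complex poly" and n :: nat
  assumes "fps_nth \<phi> 0 = 0" and "fps_nth (fps_deriv \<phi>) 0 \<noteq> 0"
    and "binomial_sequence (diff_op \<phi>) S"
    and "appell_sequence A"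
    and "\<And>t. fps_to_fls (Abs_fps (\<lambda>n. poly (A n) t / fact n)) =
               fps_to_fls (fps_exp t) / (fls_X * Dlog \<phi>)"
  shows "deviation_poly n (S n) = (delta_primitive (diff_op \<phi>) ^^ n) (A n) \<and>
         deviation_poly n (S n) =
           (boxplus n (smult (1 / of_nat (n + 1)) (diff_op \<phi> (monom 1 (n + 1)))) ^^ n) (A n)"
proof -
  define \<psi> where "\<psi> = fps_shift 1 \<phi>"
  define \<chi> where "\<chi> = inverse \<psi>"
  define d where "d = inverse (fps_deriv \<phi>)"
  have \<phi>: "\<phi> = fps_X * \<psi>"
    using assms(1) by (intro fps_ext) (simp add: \<psi>_def)
  have "fps_nth \<psi> 0 \<noteq> 0"
    using assms(2) by (simp add: \<psi>_def)
  then have \<psi>\<chi>: "\<psi> * \<chi> = 1" and nz: "\<psi> \<noteq> 0"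
    by (auto simp: \<chi>_def inverse_mult_eq_1')
  have d: "d * fps_deriv \<phi> = 1"
    using assms(2) by (simp add: d_def inverse_mult_eq_1)
  have "Abs_fps (\<lambda>n. poly (A n) t / fact n) = fps_exp t * (\<psi> * d)" for t
  proof -
    \<comment> \<open>The derivative of \<phi> is a unit among power series, so the Laurent quotient
      in the hypothesis on \<open>A\<close> is a power series and the two sides can be compared
      there.\<close>
    have "fps_to_fls d * fps_to_fls (fps_deriv \<phi>) = 1"
      by (simp flip: fls_times_fps_to_fls add: d)
    then have "inverse (fps_to_fls (fps_deriv \<phi>)) = fps_to_fls d"
      by (metis inverse_unique mult.commute)
    then have "fps_to_fls (fps_exp t) / (fls_X * Dlog \<phi>) = fps_to_fls (fps_exp t * (\<psi> * d))"
      using nz by (simp add: \<phi> X_mult_Dlog fls_times_fps_to_fls divide_inverse mult_ac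
          del: fps_deriv_mult)
    then show ?thesis
      using assms(5)[of t] by (simp only: fps_to_fls_eq_iff)
  qed
  then have A: "A n = diff_op (\<psi> * d) (monom 1 n)"
    by (rule eq_diff_op_monom_if_exp_generating_series)
  have S: "S n = diff_op (fps_deriv \<phi> * \<chi> ^ Suc n) (monom 1 n)"
    using binomial_sequence_eq_diff_op_monom[of \<psi> S \<chi> n] assms(3) \<psi>\<chi> by (simp only: \<phi>)
  \<comment> \<open>This multiplies the series of the claimed deviation polynomial by the series of
    \<open>S n\<close>. Each of the n + 1 factors \<psi> meets a \<chi>.\<close>
  have "\<psi> ^ n * (\<psi> * d) * (fps_deriv \<phi> * \<chi> ^ Suc n) = (\<psi> * \<chi>) ^ Suc n * (d * fps_deriv \<phi>)"
    by (simp add: power_mult_distrib mult_ac)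
  then have inv: "\<psi> ^ n * (\<psi> * d) * (fps_deriv \<phi> * \<chi> ^ Suc n) = 1"
    by (simp add: \<psi>\<chi> d)
  have deg: "degree (S n) = n" and "S n \<noteq> 0"
    using assms(3) by (auto simp: binomial_sequence_def) (metis degree_0 one_neq_zero)
  then have R: "deviation_poly n (S n) = diff_op (\<psi> ^ n) (A n)"
    using deviation_poly_diff_op_monom[OF _ _ S inv] by (simp add: A diff_op_mult)
  have "smult (1 / of_nat (n + 1)) (diff_op \<phi> (monom 1 (n + 1))) = diff_op \<psi> (monom 1 n)"
    by (simp add: \<phi> diff_op_X_mult_monom_Suc del: of_nat_Suc)
  \<comment> \<open>The number of iterations is separated from n, because the induction must keep
    the degree of the convolution fixed.\<close>
  moreover have "(boxplus n (diff_op \<psi> (monom 1 n)) ^^ k) (A n) = diff_op (\<psi> ^ k) (A n)" for k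
  proof (induction k)
    case (Suc k)
    have "degree (diff_op (\<psi> ^ k) (A n)) \<le> n"
      using degree_diff_op_le[of "\<psi> ^ k" "A n"] assms(4) by (simp add: appell_sequence_def)
    with Suc show ?case by (simp add: boxplus_diff_op_monom diff_op_mult)
  qed (simp add: diff_op_1)
  ultimately show ?thesis
    by (simp add: R delta_primitive_diff_op diff_op_power \<phi>)
qed

end
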